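(* Let $A$ be a hyperarithmetical set. There exists a function $f : [\omega]^2 \to 2$ such that (a) every infinite $f$-homogeneous set computes $A$, and (b) for each $i < 2$, there is an infinite $f$-homogeneous set $H$ for color $i$ whose principal function $p_H$ is dominated by a computable function.
   Context: $[\omega]^2$ denotes the set of 2-element subsets of $\omega$. A set $H$ is $f$-homogeneous (for color $i$) if $f(\{x,y\}) = i$ for all $x<y$ in $H$. The principal function of an infinite set $H = \{x_0 < x_1 < \dots\}$ is $p_H(n) = x_n$. A function $h$ dominates $p$ if $h(x) \geq p(x)$ for all $x$. *)

theory Defs
  imports Complex_Main "HOL-Library.Nat_Bijection" "HOL-Library.Infinite_Set" "HOL-Library.Ramsey"
begin

section \<open>Oracle computability\<close>

text \<open>
  Programs for the partial functions recursive in some \<open>g :: nat \<Rightarrow> nat\<close>. Programs are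
  unary; tuples of arguments are coded by the Cantor pairing \<^const>\<open>prod_encode\<close>. This is the usual
  scheme of basic functions, composition, primitive recursion and unbounded search.
\<close>

datatype prog =
    Zero | Succ | Fst | Snd | Oracle
  | Pairing prog prog | Comp prog prog | PrimRec prog prog | Search prog

inductive eval :: "(nat \<Rightarrow> nat) \<Rightarrow> prog \<Rightarrow> nat \<Rightarrow> nat \<Rightarrow> bool" for g where
  zero: "eval g Zero x 0"
| succ: "eval g Succ x (Suc x)"
| fst: "eval g Fst (prod_encode (x, y)) x"
| snd: "eval g Snd (prod_encode (x, y)) y"
| query: "eval g Oracle x (g x)"
| pairing: "eval g p x a \<Longrightarrow> eval g q x b \<Longrightarrow> eval g (Pairing p q) x (prod_encode (a, b))"
| comp: "eval g q x a \<Longrightarrow> eval g p a b \<Longrightarrow> eval g (Comp p q) x b"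
| primrec_0: "eval g p x a \<Longrightarrow> eval g (PrimRec p q) (prod_encode (x, 0)) a"
| primrec_Suc: "eval g (PrimRec p q) (prod_encode (x, n)) a \<Longrightarrow>
    eval g q (prod_encode (x, prod_encode (n, a))) b \<Longrightarrow>
    eval g (PrimRec p q) (prod_encode (x, Suc n)) b"
| search: "eval g p (prod_encode (x, n)) 0 \<Longrightarrow>
    (\<forall>m<n. \<exists>k. eval g p (prod_encode (x, m)) (Suc k)) \<Longrightarrow> eval g (Search p) x n"

text \<open>The Goedel numbering; it is a bijection, see below.\<close>

primrec code :: "prog \<Rightarrow> nat" where
  "code Zero = 0"
| "code Succ = 1"
| "code Fst = 2"
| "code Snd = 3"
| "code Oracle = 4"
| "code (Pairing p q) = 4 * prod_encode (code p, code q) + 5"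
| "code (Comp p q) = 4 * prod_encode (code p, code q) + 6"
| "code (PrimRec p q) = 4 * prod_encode (code p, code q) + 7"
| "code (Search p) = 4 * code p + 8"

text \<open>\<open>phi g e x y\<close> is \<open>\<phi>\<^sub>e\<^sup>g(x) \<down> = y\<close>.\<close>

definition phi :: "(nat \<Rightarrow> nat) \<Rightarrow> nat \<Rightarrow> nat \<Rightarrow> nat \<Rightarrow> bool" where
  "phi g e x y \<longleftrightarrow> (\<exists>p. e = code p \<and> eval g p x y)"

definition char_fun :: "nat set \<Rightarrow> nat \<Rightarrow> nat" where
  "char_fun X n = (if n \<in> X then 1 else 0)"

definition computable_from :: "(nat \<Rightarrow> nat) \<Rightarrow> (nat \<Rightarrow> nat) \<Rightarrow> bool" where
  "computable_from g h \<longleftrightarrow> (\<exists>e. \<forall>x. phi g e x (h x))"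

definition computable :: "(nat \<Rightarrow> nat) \<Rightarrow> bool" where
  "computable h \<longleftrightarrow> computable_from (\<lambda>_. 0) h"

definition computes :: "nat set \<Rightarrow> nat set \<Rightarrow> bool" where
  "computes X A \<longleftrightarrow> computable_from (char_fun X) (char_fun A)"

definition turing_jump :: "nat set \<Rightarrow> nat set" where
  "turing_jump X = {e. \<exists>y. phi (char_fun X) e e y}"

section \<open>Hyperarithmetical sets\<close>

text \<open>
  Kleene's system \<open>\<O>\<close> of ordinal notations together with its order \<open><\<^sub>\<O>\<close>: \<open>1\<close> denotes \<open>0\<close>,
  \<open>2\<^sup>a\<close> denotes the successor of \<open>a\<close>, and \<open>3 \<cdot> 5\<^sup>e\<close> denotes the limit of the \<open><\<^sub>\<O>\<close>-increasing
  sequence computed by the \<open>e\<close>-th (oracle-free) program.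
\<close>

inductive kleene_O :: "nat \<Rightarrow> bool" and less_O :: "nat \<Rightarrow> nat \<Rightarrow> bool" where
  O_zero: "kleene_O 1"
| O_suc: "kleene_O a \<Longrightarrow> kleene_O (2 ^ a)"
| O_lim: "\<lbrakk>\<And>n. phi (\<lambda>_. 0) e n (s n); \<And>n. kleene_O (s n); \<And>n. less_O (s n) (s (Suc n))\<rbrakk>
    \<Longrightarrow> kleene_O (3 * 5 ^ e)"
| less_suc: "kleene_O a \<Longrightarrow> less_O a (2 ^ a)"
| less_lim: "\<lbrakk>\<And>n. phi (\<lambda>_. 0) e n (s n); \<And>n. kleene_O (s n); \<And>n. less_O (s n) (s (Suc n))\<rbrakk>
    \<Longrightarrow> less_O (s n) (3 * 5 ^ e)"
| less_trans: "less_O a b \<Longrightarrow> less_O b c \<Longrightarrow> less_O a c"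

text \<open>
  The \<open>H\<close>-sets, by recursion along \<open>\<O>\<close>: \<open>H_set a X\<close> says that \<open>X\<close> is \<open>H\<^sub>a\<close>, the iteration of the
  jump along the notation \<open>a\<close>. The relation is the graph of a function on \<open>\<O>\<close>, see below.
\<close>

inductive H_set :: "nat \<Rightarrow> nat set \<Rightarrow> bool" where
  H_zero: "H_set 1 {}"
| H_suc: "\<lbrakk>kleene_O a; H_set a X\<rbrakk> \<Longrightarrow> H_set (2 ^ a) (turing_jump X)"
| H_lim: "\<lbrakk>kleene_O (3 * 5 ^ e); \<And>n. phi (\<lambda>_. 0) e n (s n); \<And>n. H_set (s n) (Y n)\<rbrakk>
    \<Longrightarrow> H_set (3 * 5 ^ e) {prod_encode (x, n) | x n. x \<in> Y n}"

definition hyperarithmetical :: "nat set \<Rightarrow> bool" where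
  "hyperarithmetical A \<longleftrightarrow> (\<exists>a X. kleene_O a \<and> H_set a X \<and> computes X A)"

section \<open>Homogeneous sets and domination\<close>

definition homogeneous :: "(nat set \<Rightarrow> nat) \<Rightarrow> nat \<Rightarrow> nat set \<Rightarrow> bool" where
  "homogeneous f i H \<longleftrightarrow> (\<forall>x\<in>H. \<forall>y\<in>H. x < y \<longrightarrow> f {x, y} = i)"

text \<open>Intended for infinite \<open>H\<close>; \<^const>\<open>enumerate\<close> lists the elements in increasing order.\<close>

definition principal_function :: "nat set \<Rightarrow> nat \<Rightarrow> nat" where
  "principal_function H = enumerate H"

definition dominates :: "(nat \<Rightarrow> nat) \<Rightarrow> (nat \<Rightarrow> nat) \<Rightarrow> bool" where
  "dominates h p \<longleftrightarrow> (\<forall>x. h x \<ge> p x)"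

section \<open>Well-definedness\<close>

lemma code_distinct:
  "4 * a + 5 \<noteq> 4 * b + (6::nat)" "4 * a + 5 \<noteq> 4 * b + (7::nat)" "4 * a + 5 \<noteq> 4 * b + (8::nat)"
  "4 * a + 6 \<noteq> 4 * b + (7::nat)" "4 * a + 6 \<noteq> 4 * b + (8::nat)" "4 * a + 7 \<noteq> 4 * b + (8::nat)"
  by presburger+

lemma code_inj: "code p = code q \<Longrightarrow> p = q"
proof (induction p arbitrary: q)
  case (Pairing p1 p2) then show ?case by (cases q) (simp_all add: code_distinct)
next
  case (Comp p1 p2)
  then show ?case by (cases q) (simp_all add: code_distinct code_distinct[symmetric])
next
  case (PrimRec p1 p2)
  then show ?case by (cases q) (simp_all add: code_distinct code_distinct[symmetric])
next
  case (Search p)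
  then show ?case by (cases q) (simp_all add: code_distinct code_distinct[symmetric])
next
  case Zero then show ?case by (cases q) simp_all
next
  case Succ then show ?case by (cases q) simp_all
next
  case Fst then show ?case by (cases q) simp_all
next
  case Snd then show ?case by (cases q) simp_all
next
  case Oracle then show ?case by (cases q) simp_all
qed

lemma code_surj: "\<exists>p. code p = e"
proof (induction e rule: less_induct)
  case (less e)
  show ?case
  proof (cases "e < 5")
    case True
    then have "e = 0 \<or> e = 1 \<or> e = 2 \<or> e = 3 \<or> e = 4" by linarith
    then show ?thesis by (metis code.simps(1-5))
  next
    case False
    define k where "k = (e - 5) div 4"
    obtain a b where ab: "k = prod_encode (a, b)"
      by (metis prod_decode_inverse surj_pair)
    have k: "k < e" using False by (simp add: k_def)
    have le: "a \<le> k" "b \<le> k" by (simp_all add: ab le_prod_encode_1 le_prod_encode_2)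
    obtain p q r where pq: "code p = a" "code q = b" and r: "code r = k"
      using less k le by (meson le_less_trans)
    have "e = 4 * k + 5 \<or> e = 4 * k + 6 \<or> e = 4 * k + 7 \<or> e = 4 * k + 8"
      using False unfolding k_def by presburger
    then show ?thesis
      using pq r ab by (metis code.simps(6-9))
  qed
qed

lemma bij_code: "bij code"
  unfolding bij_def inj_def surj_def using code_inj code_surj by metis

lemma eval_deterministic: "eval g p x a \<Longrightarrow> eval g p x b \<Longrightarrow> a = b"
proof (induction arbitrary: b rule: eval.induct)
  case (pairing p x a q a')
  from pairing.prems show ?case by cases (use pairing.IH in blast)
next
  case (comp q x a p a')
  from comp.prems show ?case by cases (use comp.IH in blast)
next
  case (primrec_0 p x a q)
  from primrec_0.prems show ?case by cases (use primrec_0.IH in \<open>auto\<close>)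
next
  case (primrec_Suc p q x n a a')
  from primrec_Suc.prems show ?case
    by cases (use primrec_Suc.IH in \<open>auto\<close>)
next
  case (search p x n)
  from search.prems show ?case
  proof cases
    case search': search
    show ?thesis
    proof (rule linorder_cases[of n b])
      assume "n < b"
      then obtain k where "eval g p (prod_encode (x, n)) (Suc k)" using search'(2) by blast
      then show ?thesis using search.IH(1) by blast
    next
      assume "b < n"
      then obtain k where "\<forall>c. eval g p (prod_encode (x, b)) c \<longrightarrow> Suc k = c"
        using search.IH(2) by blast
      then show ?thesis using search'(1) by blast
    qed
  qed
next
  case (fst x y) then show ?case by cases simp
next
  case (snd x y) then show ?case by cases simp
qed (erule eval.cases; simp)+

lemma phi_deterministic: "phi g e x a \<Longrightarrow> phi g e x b \<Longrightarrow> a = b"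
  unfolding phi_def using code_inj eval_deterministic by blast

lemma lim_notation_not_power_two:
  assumes "(3::nat) * 5 ^ e = 2 ^ a" shows False
proof -
  have "odd ((3::nat) * 5 ^ e)" by simp
  then have "a = 0" using assms by (metis even_power gr0I even_numeral)
  moreover have "(3::nat) * 5 ^ e \<ge> 3" by simp
  ultimately show False using assms by simp
qed

lemma kleene_O_pos: "kleene_O a \<Longrightarrow> a > 0"
  by (induction rule: kleene_O_less_O.inducts(1)[where ?P2.0 = "\<lambda>_ _. True"]) auto

lemma kleene_O_power_neq_one: "kleene_O a \<Longrightarrow> 2 ^ a \<noteq> (1::nat)"
  using kleene_O_pos[of a] by simp

lemma H_set_unique: "H_set a X \<Longrightarrow> H_set a X' \<Longrightarrow> X = X'"
proof (induction arbitrary: X' rule: H_set.induct)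
  case H_zero
  then show ?case
  proof cases
    case (H_suc b Z)
    then show ?thesis using kleene_O_power_neq_one by metis
  next
    case (H_lim e s Y)
    then show ?thesis using lim_notation_not_power_two[of e 0] by simp
  qed simp
next
  case (H_suc a X)
  from H_suc.prems show ?case
  proof cases
    case H_zero
    then show ?thesis using H_suc.hyps kleene_O_power_neq_one by metis
  next
    case (H_suc b Z)
    then show ?thesis using H_suc.IH by simp
  next
    case (H_lim e s Y)
    then show ?thesis using lim_notation_not_power_two by metis
  qed
next
  case (H_lim e s Y)
  from H_lim.prems show ?case
  proof cases
    case H_zero
    then show ?thesis using lim_notation_not_power_two[of e 0] by simp
  next
    case (H_suc b Z)
    then show ?thesis using lim_notation_not_power_two by metis
  next
    case (H_lim e' s' Y')
    then have "e' = e" by simp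
    with H_lim have "s n = s' n" for n
      using phi_deterministic \<open>\<And>n. phi (\<lambda>_. 0) e n (s n)\<close> by blast
    then have "Y n = Y' n" for n
      using H_lim H_lim.IH by metis
    then show ?thesis using H_lim by simp
  qed
qed

lemma H_set_exists: "kleene_O a \<Longrightarrow> \<exists>X. H_set a X"
proof (induction rule: kleene_O_less_O.inducts(1)[where ?P2.0 = "\<lambda>_ _. True"])
  case (O_lim e s)
  then obtain Y where "\<And>n. H_set (s n) (Y n)" by metis
  moreover have "kleene_O (3 * 5 ^ e)" by (rule kleene_O_less_O.O_lim) (use O_lim in auto)
  ultimately show ?case using H_lim O_lim(1) by blast
qed (auto intro: H_zero[unfolded One_nat_def] H_suc)

lemma H_set_ex1: "kleene_O a \<Longrightarrow> \<exists>!X. H_set a X"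
  using H_set_exists H_set_unique by blast

end

(*
  Every hyperarithmetical A has a modulus (Solovay): a function g such that every h dominating g
  computes A. Let g bound, for all notations c, the stage at which a computation relative to H_c
  halts if it halts at all; from h dominating g one decides membership in the sets H_b by recursion
  along the notations, because h tells how long to wait before declaring a computation divergent.

  Split omega into three classes: codes of the restrictions A|n with n even, codes with n odd, and
  the remaining numbers. Give a pair x < y colour 0 if both members lie in the first class, or if
  both lie in the third and y > g x; otherwise colour 1. Then an infinite homogeneous set either
  consists of codes up to finitely many elements and computes A by reading them, or lies in the
  third class and is so sparse that it computes a function dominating g. The first two classes are
  homogeneous themselves, and the code of A|n is less than 2^(n+1).
*)
theory Submission
  imports Defs
begin

section \<open>Closure properties of relative computability\<close>

text \<open>
  A function of several arguments is presented to \<^const>\<open>computable_from\<close> as a function of one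
  context \<open>x\<close>, and a bound variable is paired onto the context. The closure rules below are stated
  so that \<open>intro comp_intros\<close> establishes computability by recursion on the syntax of a term.
\<close>

definition pfst :: "nat \<Rightarrow> nat" where "pfst z = fst (prod_decode z)"
definition psnd :: "nat \<Rightarrow> nat" where "psnd z = snd (prod_decode z)"

lemma pfst_encode [simp]: "pfst (prod_encode (a, b)) = a"
  and psnd_encode [simp]: "psnd (prod_encode (a, b)) = b"
  and encode_pfst_psnd [simp]: "prod_encode (pfst z, psnd z) = z"
  by (simp_all add: pfst_def psnd_def)

lemma pfst_le: "pfst z \<le> z" and psnd_le: "psnd z \<le> z"
  by (metis encode_pfst_psnd le_prod_encode_1) (metis encode_pfst_psnd le_prod_encode_2)

text \<open>Injectivity of \<open>code\<close> makes the program uniform: \<open>phi\<close> only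
  offers a program for each argument separately, and all of these have the same code.\<close>

lemma computable_from_iff: "computable_from g f \<longleftrightarrow> (\<exists>p. \<forall>x. eval g p
    x (f x))"
  unfolding computable_from_def phi_def by (metis code_inj code_surj)

lemma computable_from_const: "computable_from g (\<lambda>_. c)"
proof -
  have "\<exists>p. \<forall>x. eval g p x c"
  proof (induction c)
    case 0
    then show ?case by (auto intro: eval.zero)
  next
    case (Suc c)
    then show ?case by (meson eval.comp eval.succ)
  qed
  then show ?thesis by (simp add: computable_from_iff)
qed

lemma computable_from_cong: "computable_from g f \<Longrightarrow> (\<And>x. f x = f' x)
    \<Longrightarrow> computable_from g f'"
  by (simp add: computable_from_def)

lemma eval_Fst: "eval g Fst z (pfst z)" and eval_Snd: "eval g Snd z (psnd z)"
  using eval.fst[of g "pfst z" "psnd z"] eval.snd[of g "pfst z" "psnd z"] by simp_all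

text \<open>There is no identity among the basic programs; since every number codes a pair,
  splitting it and pairing the two halves again gives it back.\<close>

lemma computable_from_id: "computable_from g (\<lambda>x. x)"
  using eval.pairing[OF eval_Fst eval_Snd] by (auto simp: computable_from_iff)

lemma computable_from_comp: "computable_from g f \<Longrightarrow> computable_from g k
    \<Longrightarrow> computable_from g (\<lambda>x. f (k x))"
  unfolding computable_from_iff by (meson eval.comp)

lemma computable_from_pfst: "computable_from g a \<Longrightarrow> computable_from g (\<lambda>x. pfst (a x))"
  unfolding computable_from_iff by (meson eval.comp eval_Fst)

lemma computable_from_psnd: "computable_from g a \<Longrightarrow> computable_from g (\<lambda>x. psnd (a x))"
  unfolding computable_from_iff by (meson eval.comp eval_Snd)

lemma computable_from_Suc: "computable_from g a \<Longrightarrow> computable_from g (\<lambda>x. Suc (a x))"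
  unfolding computable_from_iff by (meson eval.comp eval.succ)

lemma computable_from_oracle: "computable_from g a \<Longrightarrow> computable_from g (\<lambda>x. g (a x))"
  unfolding computable_from_iff by (meson eval.comp eval.query)

lemma computable_from_pair: "computable_from g a \<Longrightarrow> computable_from g b \<Longrightarrow>
    computable_from g (\<lambda>x. prod_encode (a x, b x))"
  unfolding computable_from_iff by (meson eval.pairing)

lemma computable_from_comp2:
  assumes "computable_from g (\<lambda>z. f (pfst z) (psnd z))" "computable_from g a" "computable_from g b"
  shows "computable_from g (\<lambda>x. f (a x) (b x))"
  using computable_from_comp[OF assms(1) computable_from_pair[OF assms(2,3)]] by simp

text \<open>\<open>PrimRec\<close> runs on the pair of context and counter, so the context stays
  fixed through the recursion and the step \<open>q\<close> may depend on it. The bound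
  \<open>k x\<close> is supplied afterwards by composition.\<close>

lemma computable_from_rec:
  assumes "computable_from g a" "computable_from g k"
    and "computable_from g (\<lambda>z. q (pfst z) (pfst (psnd z)) (psnd (psnd z)))"
  shows "computable_from g (\<lambda>x. rec_nat (a x) (q x) (k x))"
proof -
  obtain pa pq where pa: "\<And>x. eval g pa x (a x)"
    and pq: "\<And>z. eval g pq z (q (pfst z) (pfst (psnd z)) (psnd (psnd z)))"
    using assms unfolding computable_from_iff by metis
  have "eval g (PrimRec pa pq) (prod_encode (x, n)) (rec_nat (a x) (q x) n)" for x n
  proof (induction n)
    case 0
    show ?case using eval.primrec_0[OF pa] by simp
  next
    case (Suc n)
    show ?case using eval.primrec_Suc[OF Suc, of "q x n (rec_nat (a x) (q x) n)"]
      pq[of "prod_encode (x, prod_encode (n, rec_nat (a x) (q x) n))"] by simp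
  qed
  then have "computable_from g (\<lambda>z. rec_nat (a (pfst z)) (q (pfst z)) (psnd z))"
    unfolding computable_from_iff by (metis encode_pfst_psnd)
  from computable_from_comp2[OF this computable_from_id assms(2)] show ?thesis by simp
qed

lemma computable_from_add: assumes "computable_from g a" "computable_from g b"
  shows "computable_from g (\<lambda>x. a x + b x)"
proof -
  have "rec_nat m (\<lambda>_ r. Suc r) n = m + n" for m n by (induction n) auto
  moreover have "computable_from g (\<lambda>x. rec_nat (a x) (\<lambda>_ r. Suc r) (b x))"
    by (intro computable_from_rec assms computable_from_Suc computable_from_psnd computable_from_id)
  ultimately show ?thesis by simp
qed

lemma computable_from_mult: assumes "computable_from g a" "computable_from g b"
  shows "computable_from g (\<lambda>x. a x * b x)"
proof -
  have "rec_nat 0 (\<lambda>_ r. r + m) n = m * n" for m n by (induction n) auto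
  moreover have "computable_from g (\<lambda>x. rec_nat 0 (\<lambda>_ r. r + a x) (b x))"
    by (intro computable_from_rec assms computable_from_const computable_from_add
        computable_from_comp[OF assms(1)] computable_from_pfst computable_from_psnd computable_from_id)
  ultimately show ?thesis by simp
qed

lemma computable_from_power: assumes "computable_from g a" "computable_from g b"
  shows "computable_from g (\<lambda>x. a x ^ b x)"
proof -
  have "rec_nat 1 (\<lambda>_ r. r * m) n = m ^ n" for m n :: nat by (induction n) auto
  moreover have "computable_from g (\<lambda>x. rec_nat 1 (\<lambda>_ r. r * a x) (b x))"
    by (intro computable_from_rec assms computable_from_const computable_from_mult
        computable_from_comp[OF assms(1)] computable_from_pfst computable_from_psnd computable_from_id)
  ultimately show ?thesis by simp
qed

lemma computable_from_diff: assumes "computable_from g a" "computable_from g b"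
  shows "computable_from g (\<lambda>x. a x - b x)"
proof -
  have pred: "rec_nat 0 (\<lambda>k _. k) n = n - 1" for n by (cases n) auto
  have "computable_from g (\<lambda>x. rec_nat 0 (\<lambda>k _. k) x)"
    by (intro computable_from_rec computable_from_const computable_from_pfst computable_from_psnd
        computable_from_id)
  then have pred': "computable_from g (\<lambda>x. x - 1)" by (simp add: pred)
  have "rec_nat m (\<lambda>_ r. r - 1) n = m - n" for m n by (induction n) auto
  moreover have "computable_from g (\<lambda>x. rec_nat (a x) (\<lambda>_ r. r - 1) (b x))"
    by (intro computable_from_rec assms computable_from_comp[OF pred'] computable_from_psnd computable_from_id)
  ultimately show ?thesis by simp
qed

section \<open>Decidable predicates, bounded quantifiers and search\<close>

definition decidable_from :: "(nat \<Rightarrow> nat) \<Rightarrow> (nat \<Rightarrow> bool)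
    \<Rightarrow> bool" where
  "decidable_from g P \<longleftrightarrow> computable_from g (\<lambda>x. if P x then 1 else 0)"

lemma decidable_from_eq: assumes "computable_from g a" "computable_from g b"
  shows "decidable_from g (\<lambda>x. a x = b x)"
proof -
  have "computable_from g (\<lambda>x. 1 - ((a x - b x) + (b x - a x)))"
    by (intro computable_from_diff computable_from_add assms computable_from_const)
  moreover have "1 - ((m - n) + (n - m)) = (if m = n then 1 else 0)" for m n :: nat by auto
  ultimately show ?thesis by (simp add: decidable_from_def)
qed

text \<open>Both branches are total, so both can be evaluated and weighted with the indicator of
  \<open>P\<close> and its complement.\<close>

lemma computable_from_if: assumes "decidable_from g P" "computable_from g a" "computable_from g b"
  shows "computable_from g (\<lambda>x. if P x then a x else b x)"
proof -
  have "computable_from g (\<lambda>x. (if P x then 1 else 0) * a x + (1 - (if P x then 1 else 0)) * b x)"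
    using assms(1) unfolding decidable_from_def by (intro computable_from_diff computable_from_add
        computable_from_mult assms(2,3) computable_from_const)
  then show ?thesis by (rule computable_from_cong) auto
qed

lemma decidable_from_not: "decidable_from g P \<Longrightarrow> decidable_from g (\<lambda>x. \<not> P x)"
  and decidable_from_conj: "decidable_from g P \<Longrightarrow> decidable_from g Q \<Longrightarrow>
      decidable_from g (\<lambda>x. P x \<and> Q x)"
  and decidable_from_disj: "decidable_from g P \<Longrightarrow> decidable_from g Q \<Longrightarrow>
      decidable_from g (\<lambda>x. P x \<or> Q x)"
proof -
  assume P: "decidable_from g P"
  have "computable_from g (\<lambda>x. if P x then 0 else 1)"
    by (intro computable_from_if P computable_from_const)
  then show "decidable_from g (\<lambda>x. \<not> P x)"
    unfolding decidable_from_def by (rule computable_from_cong) auto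
next
  assume P: "decidable_from g P" and Q: "decidable_from g Q"
  have "computable_from g (\<lambda>x. if P x then if Q x then 1 else 0 else 0)"
    by (intro computable_from_if P Q computable_from_const)
  then show "decidable_from g (\<lambda>x. P x \<and> Q x)"
    unfolding decidable_from_def by (rule computable_from_cong) auto
  have "computable_from g (\<lambda>x. if P x then 1 else if Q x then 1 else 0)"
    by (intro computable_from_if P Q computable_from_const)
  then show "decidable_from g (\<lambda>x. P x \<or> Q x)"
    unfolding decidable_from_def by (rule computable_from_cong) auto
qed

lemma decidable_from_comp: "decidable_from g P \<Longrightarrow> computable_from g k \<Longrightarrow>
    decidable_from g (\<lambda>x. P (k x))"
  unfolding decidable_from_def by (rule computable_from_comp)

lemma decidable_from_comp2:
  assumes "decidable_from g (\<lambda>z. P (pfst z) (psnd z))" "computable_from g a" "computable_from g b"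
  shows "decidable_from g (\<lambda>x. P (a x) (b x))"
  using decidable_from_comp[OF assms(1) computable_from_pair[OF assms(2,3)]] by simp

lemma decidable_from_less: assumes "computable_from g a" "computable_from g b"
  shows "decidable_from g (\<lambda>x. a x < b x)"
proof -
  have "decidable_from g (\<lambda>x. \<not> b x - a x = 0)" by (intro decidable_from_not
      decidable_from_eq computable_from_diff assms computable_from_const)
  moreover have "(\<not> n - m = 0) = (m < n)" for m n :: nat by auto
  ultimately show ?thesis by simp
qed

lemma decidable_from_bex:
  assumes "computable_from g b" "decidable_from g (\<lambda>z. P (pfst z) (psnd z))"
  shows "decidable_from g (\<lambda>x. \<exists>i<b x. P x i)"
proof -
  let ?r = "\<lambda>x n. rec_nat 0 (\<lambda>i r. if P x i \<or> r = 1 then 1 else 0) n"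
  have "computable_from g (\<lambda>x. ?r x (b x))"
    by (intro computable_from_rec assms computable_from_const computable_from_if decidable_from_disj
        decidable_from_eq decidable_from_comp2[OF assms(2)] computable_from_pfst computable_from_psnd
        computable_from_id)
  moreover have "?r x n = (if \<exists>i<n. P x i then 1 else 0)" for x n
    by (induction n) (auto simp: less_Suc_eq)
  ultimately show ?thesis unfolding decidable_from_def by (rule computable_from_cong)
qed

lemma decidable_from_ball:
  assumes "computable_from g b" "decidable_from g (\<lambda>z. P (pfst z) (psnd z))"
  shows "decidable_from g (\<lambda>x. \<forall>i<b x. P x i)"
proof -
  have "decidable_from g (\<lambda>x. \<not> (\<exists>i<b x. \<not> P x i))"
    by (intro decidable_from_not decidable_from_bex assms)
  then show ?thesis by simp
qed

lemma computable_from_Least: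
  assumes "decidable_from g (\<lambda>z. P (pfst z) (psnd z))" and ex: "\<And>x. \<exists>n. P x n"
  shows "computable_from g (\<lambda>x. LEAST n. P x n)"
proof -
  \<comment> \<open>The indicator is inverted because \<open>Search\<close> looks for the value
    0.\<close>
  have "computable_from g (\<lambda>z. if P (pfst z) (psnd z) then 0 else 1)"
    by (intro computable_from_if assms(1) computable_from_const)
  then obtain p where p: "\<And>z. eval g p z (if P (pfst z) (psnd z) then 0 else 1)"
    unfolding computable_from_iff by metis
  have "eval g (Search p) x (LEAST n. P x n)" for x
  proof (rule eval.search)
    show "eval g p (prod_encode (x, LEAST n. P x n)) 0"
      using p[of "prod_encode (x, LEAST n. P x n)"] LeastI_ex[OF ex[of x]] by simp
    show "\<forall>m<LEAST n. P x n. \<exists>k. eval g p (prod_encode (x, m)) (Suc k)"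
    proof (intro allI impI exI)
      fix m assume "m < (LEAST n. P x n)"
      then have "\<not> P x m" by (rule not_less_Least)
      then show "eval g p (prod_encode (x, m)) (Suc 0)"
        using p[of "prod_encode (x, m)"] by simp
    qed
  qed
  then show ?thesis unfolding computable_from_iff by blast
qed

text \<open>Bit \<open>z\<close> of \<open>s\<close> is set iff \<open>s\<close> is an odd multiple
  of \<open>2 ^ z\<close> plus a remainder below \<open>2 ^ z\<close>. Multiplier and remainder are
  at most \<open>s\<close>, so a bounded search takes the place of division.\<close>

lemma decidable_from_set_decode: assumes "computable_from g a" "computable_from g b"
  shows "decidable_from g (\<lambda>x. a x \<in> set_decode (b x))"
proof -
  have "(\<exists>i<Suc s. \<exists>j<Suc s. s = (2 * i + 1) * 2 ^ z + j \<and> j < 2 ^ z)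
      \<longleftrightarrow> z \<in> set_decode s"
    (is "?L \<longleftrightarrow> _") for s z
  proof
    assume ?L
    then obtain i j where s: "s = (2 * i + 1) * 2 ^ z + j" "j < 2 ^ z" by blast
    then have "s div 2 ^ z = 2 * i + 1"
      by (metis add.commute add_0 div_less div_mult_self3 less_nat_zero_code)
    then show "z \<in> set_decode s" by (simp add: set_decode_def)
  next
    assume "z \<in> set_decode s"
    then have "odd (s div 2 ^ z)" by (simp add: set_decode_def)
    then obtain i where i: "s div 2 ^ z = 2 * i + 1" by (elim oddE)
    have s: "s = (2 * i + 1) * 2 ^ z + s mod 2 ^ z"
      by (metis i div_mult_mod_eq)
    moreover have "i \<le> s" using i by (metis add_leD1 div_le_dividend le_add1 mult_2 order_trans)
    moreover have "s mod 2 ^ z < 2 ^ z" "s mod 2 ^ z < Suc s" by (simp_all add: less_Suc_eq_le)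
    ultimately show ?L by (metis le_imp_less_Suc)
  qed
  moreover have "decidable_from g (\<lambda>x. \<exists>i<Suc (b x). \<exists>j<Suc (b x).
      b x = (2 * i + 1) * 2 ^ a x + j \<and> j < 2 ^ a x)"
    by (intro decidable_from_bex decidable_from_conj decidable_from_eq decidable_from_less
        computable_from_add computable_from_mult computable_from_power computable_from_Suc
      computable_from_comp[OF assms(1)] computable_from_comp[OF assms(2)] computable_from_const
          computable_from_pfst computable_from_psnd computable_from_id assms)
  ultimately show ?thesis by simp
qed

lemmas comp_intros = computable_from_id computable_from_const computable_from_pfst computable_from_psnd
    computable_from_Suc computable_from_pair computable_from_add computable_from_mult
    computable_from_power computable_from_diff computable_from_if
  decidable_from_eq decidable_from_less decidable_from_not decidable_from_conj decidable_from_disj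
      decidable_from_bex decidable_from_ball decidable_from_set_decode

text \<open>Each call of \<open>Oracle\<close> is replaced by a program for \<open>h\<close>. The
  induction carries over every defined value of a possibly partial program, which suffices for the
  total function \<open>f\<close>.\<close>

lemma computable_from_trans:
  assumes "computable_from g h" "computable_from h f"
  shows "computable_from g f"
proof -
  obtain q where q: "\<And>x. eval g q x (h x)" using assms(1) unfolding computable_from_iff by blast
  have "\<exists>p'. \<forall>x y. eval h p x y \<longrightarrow> eval g p' x y" for p
  proof (induction p)
    case Zero
    show ?case by (rule exI[of _ Zero]) (auto elim: eval.cases intro: eval.intros)
  next
    case Succ
    show ?case by (rule exI[of _ Succ]) (auto elim: eval.cases intro: eval.intros)
  next
    case Fst
    show ?case by (rule exI[of _ Fst]) (auto elim: eval.cases intro: eval.intros)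
  next
    case Snd
    show ?case by (rule exI[of _ Snd]) (auto elim: eval.cases intro: eval.intros)
  next
    case Oracle
    show ?case by (rule exI[of _ q]) (auto elim: eval.cases intro: q)
  next
    case (Pairing p1 p2)
    then obtain q1 q2 where "\<forall>x y. eval h p1 x y \<longrightarrow> eval g q1 x y"
      "\<forall>x y. eval h p2 x y \<longrightarrow> eval g q2 x y" by blast
    then show ?case
      by (intro exI[of _ "Pairing q1 q2"]) (auto elim!: eval.cases[of h "Pairing p1 p2"] intro: eval.intros)
  next
    case (Comp p1 p2)
    then obtain q1 q2 where "\<forall>x y. eval h p1 x y \<longrightarrow> eval g q1 x y"
      "\<forall>x y. eval h p2 x y \<longrightarrow> eval g q2 x y" by blast
    then show ?case
      by (intro exI[of _ "Comp q1 q2"]) (auto elim!: eval.cases[of h "Comp p1 p2"], metis eval.comp)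
  next
    case (PrimRec p1 p2)
    then obtain q1 q2 where q: "\<forall>x y. eval h p1 x y \<longrightarrow> eval g q1 x y"
      "\<forall>x y. eval h p2 x y \<longrightarrow> eval g q2 x y" by blast
    \<comment> \<open>The successor clause calls the same program again, so the counter needs an
      induction of its own.\<close>
    have "eval h (PrimRec p1 p2) (prod_encode (x, n)) y \<Longrightarrow>
        eval g (PrimRec q1 q2) (prod_encode (x, n)) y" for x n y
    proof (induction n arbitrary: y)
      case 0
      then show ?case by cases (auto intro: eval.primrec_0 q[rule_format])
    next
      case (Suc n)
      from Suc.prems show ?case
        by cases (auto intro!: eval.primrec_Suc Suc.IH q(2)[rule_format])
    qed
    then show ?case by (metis encode_pfst_psnd)
  next
    case (Search p1)
    then obtain q1 where "\<forall>x y. eval h p1 x y \<longrightarrow> eval g q1 x y" by blast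
    then show ?case
      by (intro exI[of _ "Search q1"])
        (auto elim!: eval.cases[of h "Search p1"] intro!: eval.search, blast)
  qed
  then show ?thesis using assms(2) unfolding computable_from_iff by blast
qed

section \<open>Enumeration of computations\<close>

text \<open>
  \<open>stage \<Phi> t\<close> codes, as a bit set, the numbers put in before stage \<open>t\<close>.
      Stage \<open>t\<close> examines only
  \<open>pfst t\<close>, so that every number is examined at arbitrarily late stages.
\<close>

primrec stage :: "(nat \<Rightarrow> nat \<Rightarrow> nat \<Rightarrow> bool) \<Rightarrow> nat
    \<Rightarrow> nat" where
  "stage \<Phi> 0 = 0"
| "stage \<Phi> (Suc t) = (if \<Phi> t (stage \<Phi> t) (pfst t) \<and> pfst t \<notin> set_decode
    (stage \<Phi> t)
     then stage \<Phi> t + 2 ^ pfst t else stage \<Phi> t)"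

text \<open>The guard in \<open>stage\<close> adds \<open>2 ^ pfst t\<close> only if that bit is
  still clear, so no carry disturbs the other bits.\<close>

lemma set_decode_stage_Suc:
  "set_decode (stage \<Phi> (Suc t)) =
    set_decode (stage \<Phi> t) \<union> (if \<Phi> t (stage \<Phi> t) (pfst t) then {pfst t} else {})"
proof (cases "pfst t \<in> set_decode (stage \<Phi> t)")
  case True
  then show ?thesis by auto
next
  case False
  then have "set_decode (2 ^ pfst t + stage \<Phi> t) = insert (pfst t) (set_decode (stage \<Phi> t))"
    by (rule set_decode_plus_power_2)
  with False show ?thesis by (simp add: add.commute)
qed

declare stage.simps(2) [simp del]

lemma stage_mono: "s \<le> t \<Longrightarrow> set_decode (stage \<Phi> s) \<subseteq> set_decode
    (stage \<Phi> t)"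
  by (rule lift_Suc_mono_le) (simp_all add: set_decode_stage_Suc)

lemma stage_sound: "z \<in> set_decode (stage \<Phi> t) \<Longrightarrow> \<exists>s<t. \<Phi> s (stage
    \<Phi> s) z"
  by (induction t) (auto simp: set_decode_stage_Suc less_Suc_eq split: if_splits)

text \<open>Stage \<open>prod_encode (z, s0)\<close> examines \<open>z\<close> and does not come
  before \<open>s0\<close>.\<close>

lemma stage_complete:
  assumes "\<And>s. s \<ge> s0 \<Longrightarrow> \<Phi> s (stage \<Phi> s) z"
  shows "\<exists>t. z \<in> set_decode (stage \<Phi> t)"
proof -
  have "s0 \<le> prod_encode (z, s0)" by (rule le_prod_encode_2)
  from assms[OF this] have "z \<in> set_decode (stage \<Phi> (Suc (prod_encode (z, s0))))"
    by (simp add: set_decode_stage_Suc)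
  then show ?thesis ..
qed

lemma mem_set_decode_less: "z \<in> set_decode S \<Longrightarrow> z < S"
proof -
  assume "z \<in> set_decode S"
  then have "S div 2 ^ z \<noteq> 0" by (auto simp: set_decode_def elim: oddE)
  then have "2 ^ z \<le> S" by (simp add: div_eq_0_iff not_less)
  then show "z < S" using less_exp[of z] by linarith
qed

text \<open>The rule may vary with the context \<open>a x\<close>. This is what later allows a
  simulated oracle that is itself read off from a stage.\<close>

lemma computable_from_stage:
  assumes \<Phi>: "decidable_from g (\<lambda>w. \<Phi> (pfst w) (pfst (psnd w)) (pfst (psnd (psnd w)))
      (psnd (psnd (psnd w))))"
    and a: "computable_from g a" and k: "computable_from g k"
  shows "computable_from g (\<lambda>x. stage (\<Phi> (a x)) (k x))"
proof -
  have \<Phi>': "decidable_from g (\<lambda>x. \<Phi> (p x) (q x) (r x) (s x))"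
    if "computable_from g p" "computable_from g q" "computable_from g r" "computable_from g s" for p q r s
    using decidable_from_comp[OF \<Phi> computable_from_pair[OF that(1) computable_from_pair[OF that(2)
        computable_from_pair[OF that(3,4)]]]] by simp
  have "stage \<Psi> t = rec_nat 0 (\<lambda>t S. if \<Psi> t S (pfst t) \<and> pfst t \<notin> set_decode S
      then S + 2 ^ pfst t else S) t" for \<Psi> t
    by (induction t) (simp_all add: stage.simps(2))
  then show ?thesis
    by (simp only:) (intro computable_from_rec \<Phi>' comp_intros computable_from_comp[OF a] k)
qed

abbreviation fact_code :: "nat \<Rightarrow> nat \<Rightarrow> nat \<Rightarrow> nat" where
  "fact_code e x y \<equiv> prod_encode (e, prod_encode (x, y))"

text \<open>
  The disjuncts follow the clauses of \<^const>\<open>code\<close>. The bounds \<open>k < e\<close> and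
      \<open>a < S\<close> are no
  restriction (a member of \<open>set_decode S\<close> is below \<open>S\<close>) but make the search decidable.
\<close>

definition eval_step :: "(nat \<Rightarrow> nat) \<Rightarrow> nat \<Rightarrow> nat \<Rightarrow> nat
    \<Rightarrow> bool" where
  "eval_step g t S z = (let e = pfst z; x = pfst (psnd z); y = psnd (psnd z) in
     (e = 0 \<and> y = 0) \<or> (e = 1 \<and> y = Suc x) \<or> (e = 2 \<and> y = pfst x) \<or> (e = 3
         \<and> y = psnd x) \<or>
     (e = 4 \<and> y = g x) \<or>
     (\<exists>k<e. e = 4 * k + 5 \<and> fact_code (pfst k) x (pfst y) \<in> set_decode S \<and>
        fact_code (psnd k) x (psnd y) \<in> set_decode S) \<or>
     (\<exists>k<e. e = 4 * k + 6 \<and> (\<exists>a<S. fact_code (psnd k) x a \<in> set_decode S \<and>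
        fact_code (pfst k) a y \<in> set_decode S)) \<or>
     (\<exists>k<e. e = 4 * k + 7 \<and> psnd x = 0 \<and> fact_code (pfst k) (pfst x) y \<in>
         set_decode S) \<or>
     (\<exists>k<e. e = 4 * k + 7 \<and> (\<exists>n<psnd x. psnd x = Suc n \<and>
        (\<exists>a<S. fact_code e (prod_encode (pfst x, n)) a \<in> set_decode S \<and>
           fact_code (psnd k) (prod_encode (pfst x, prod_encode (n, a))) y \<in> set_decode S))) \<or>
     (\<exists>k<e. e = 4 * k + 8 \<and> fact_code k (prod_encode (x, y)) 0 \<in> set_decode S \<and>
        (\<forall>m<y. \<exists>a<S. fact_code k (prod_encode (x, m)) (Suc a) \<in> set_decode S)))"

lemma computable_from_eval_stage:
  assumes G: "computable_from g (\<lambda>w. G (pfst w) (psnd w))" and k: "computable_from g k"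
  shows "computable_from g (\<lambda>x. stage (eval_step (G x)) (k x))"
  by (rule computable_from_stage[where \<Phi> = "\<lambda>x. eval_step (G x)", OF _ computable_from_id k])
    (unfold eval_step_def Let_def, intro computable_from_comp2[OF G] comp_intros)

text \<open>The code of a program determines its outermost constructor, so exactly the disjuncts for
  that constructor survive, and they are the premises of the corresponding rules of
  \<open>eval\<close>.\<close>

lemma eval_step_sound:
  assumes S: "\<And>e x y. fact_code e x y \<in> set_decode S \<Longrightarrow> phi g e x y"
    and "eval_step g t S (fact_code e x y)"
  shows "phi g e x y"
proof -
  have S: "eval g p x y" if "fact_code (code p) x y \<in> set_decode S" for p x y
    using S[OF that] code_inj unfolding phi_def by blast
  obtain p where p: "e = code p" using code_surj by metis
  obtain y1 y2 where y: "y = prod_encode (y1, y2)" by (metis encode_pfst_psnd)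
  obtain x1 x2 where x: "x = prod_encode (x1, x2)" by (metis encode_pfst_psnd)
  have "eval g p x y"
  proof (cases p)
    case Zero
    then show ?thesis using assms(2) by (auto simp: p eval_step_def intro: eval.intros)
  next
    case Succ
    then show ?thesis using assms(2) by (auto simp: p eval_step_def intro: eval.intros)
  next
    case Fst
    then show ?thesis using assms(2) by (auto simp: p eval_step_def x intro: eval.intros)
  next
    case Snd
    then show ?thesis using assms(2) by (auto simp: p eval_step_def x intro: eval.intros)
  next
    case Oracle
    then show ?thesis using assms(2) by (auto simp: p eval_step_def intro: eval.intros)
  next
    case (Pairing p1 p2)
    then show ?thesis using assms(2)
      by (auto simp: p eval_step_def y code_distinct code_distinct[symmetric] dest!: S intro: eval.pairing)
  next
    case (Comp p1 p2)
    then show ?thesis using assms(2)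
      by (auto simp: p eval_step_def code_distinct code_distinct[symmetric] dest!: S intro: eval.comp)
  next
    case (PrimRec p1 p2)
    \<comment> \<open>Here a premise concerns the same program at a smaller counter, hence the extra
      instance of \<open>S\<close>.\<close>
    then show ?thesis using assms(2) S[of "PrimRec p1 p2"]
      by (auto simp: p eval_step_def x code_distinct code_distinct[symmetric] dest!: S
        intro: eval.primrec_0 eval.primrec_Suc)
  next
    case (Search p1)
    then have "fact_code (code p1) (prod_encode (x, y)) 0 \<in> set_decode S"
      "\<forall>m<y. \<exists>a<S. fact_code (code p1) (prod_encode (x, m)) (Suc a) \<in> set_decode S"
      using assms(2) by (auto simp: p eval_step_def code_distinct code_distinct[symmetric])
    then show ?thesis unfolding Search by (intro eval.search) (use S in blast)+
  qed
  then show ?thesis by (auto simp: p phi_def)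
qed

lemma eval_stage_sound: "fact_code e x y \<in> set_decode (stage (eval_step g) t) \<Longrightarrow> phi g e x y"
proof (induction t arbitrary: e x y rule: less_induct)
  case (less t)
  from stage_sound[OF less.prems] show ?case using eval_step_sound less.IH by blast
qed

lemma fact_code_bound: "fact_code e x y \<in> set_decode S \<Longrightarrow> y < S"
  using mem_set_decode_less le_prod_encode_2 by (meson le_less_trans)

text \<open>Once the premises of a rule have been entered they remain, so the conclusion qualifies
  at all later stages and \<open>stage_complete\<close> applies.\<close>

lemma eval_stage_complete: "eval g p x y \<Longrightarrow> \<exists>t. fact_code (code p) x y \<in>
    set_decode (stage (eval_step g) t)"
proof (induction rule: eval.induct)
  case (pairing p x a q b)
  then obtain t1 t2 where t: "fact_code (code p) x a \<in> set_decode (stage (eval_step g) t1)"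
    "fact_code (code q) x b \<in> set_decode (stage (eval_step g) t2)" by blast
  show ?case
  proof (rule stage_complete[of "max t1 t2"])
    fix s assume "max t1 t2 \<le> s"
    then have "fact_code (code p) x a \<in> set_decode (stage (eval_step g) s)"
      "fact_code (code q) x b \<in> set_decode (stage (eval_step g) s)"
      using t stage_mono[THEN subsetD] by auto
    then show "eval_step g s (stage (eval_step g) s) (fact_code (code (Pairing p q)) x (prod_encode (a, b)))"
      by (auto simp: eval_step_def Let_def)
  qed
next
  case (comp q x a p b)
  then obtain t1 t2 where t: "fact_code (code q) x a \<in> set_decode (stage (eval_step g) t1)"
    "fact_code (code p) a b \<in> set_decode (stage (eval_step g) t2)" by blast
  show ?case
  proof (rule stage_complete[of "max t1 t2"])
    fix s assume "max t1 t2 \<le> s"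
    then have "fact_code (code q) x a \<in> set_decode (stage (eval_step g) s)"
      "fact_code (code p) a b \<in> set_decode (stage (eval_step g) s)"
      using t stage_mono[THEN subsetD] by auto
    then show "eval_step g s (stage (eval_step g) s) (fact_code (code (Comp p q)) x b)"
      using fact_code_bound by (auto simp: eval_step_def Let_def)
  qed
next
  case (primrec_0 p x a q)
  then obtain t1 where t: "fact_code (code p) x a \<in> set_decode (stage (eval_step g) t1)" by blast
  show ?case
  proof (rule stage_complete[of t1])
    fix s assume "t1 \<le> s"
    then have "fact_code (code p) x a \<in> set_decode (stage (eval_step g) s)"
      using t stage_mono[THEN subsetD] by auto
    then show "eval_step g s (stage (eval_step g) s) (fact_code (code (PrimRec p q)) (prod_encode (x, 0)) a)"
      by (auto simp: eval_step_def Let_def)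
  qed
next
  case (primrec_Suc p q x n a b)
  then obtain t1 t2 where t:
    "fact_code (code (PrimRec p q)) (prod_encode (x, n)) a \<in> set_decode (stage (eval_step g) t1)"
    "fact_code (code q) (prod_encode (x, prod_encode (n, a))) b \<in> set_decode (stage (eval_step g)
        t2)" by blast
  show ?case
  proof (rule stage_complete[of "max t1 t2"])
    fix s assume "max t1 t2 \<le> s"
    then have "fact_code (code (PrimRec p q)) (prod_encode (x, n)) a \<in> set_decode (stage (eval_step g) s)"
      "fact_code (code q) (prod_encode (x, prod_encode (n, a))) b \<in> set_decode (stage (eval_step g) s)"
      using t stage_mono[THEN subsetD] by auto
    then show "eval_step g s (stage (eval_step g) s) (fact_code (code (PrimRec p q)) (prod_encode (x,
        Suc n)) b)"
      using fact_code_bound by (auto simp: eval_step_def Let_def)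
  qed
next
  case (search p x n)
  let ?T = "\<lambda>t. set_decode (stage (eval_step g) t)"
  obtain t0 where t0: "fact_code (code p) (prod_encode (x, n)) 0 \<in> ?T t0"
    using search by blast
  obtain k t where t: "\<forall>m<n. fact_code (code p) (prod_encode (x, m)) (Suc (k m)) \<in> ?T (t m)"
    using search.IH by metis
  \<comment> \<open>An unbounded search rests on one premise for each \<open>m < n\<close>; being
    finitely many, they are all present from a common stage \<open>t1\<close> on.\<close>
  have "finite (t ` {..<n})" by simp
  then obtain t1 where t1: "\<And>m. m < n \<Longrightarrow> t m \<le> t1"
    by (metis finite_nat_set_iff_bounded_le imageI lessThan_iff)
  show ?case
  proof (rule stage_complete[of "max t0 t1"])
    fix s assume s: "max t0 t1 \<le> s"
    then have "fact_code (code p) (prod_encode (x, n)) 0 \<in> ?T s"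
      using t0 stage_mono[THEN subsetD] by auto
    moreover have "\<exists>a<stage (eval_step g) s. fact_code (code p) (prod_encode (x, m)) (Suc a) \<in> ?T s"
      if "m < n" for m
    proof -
      have "t m \<le> s" using t1[OF that] s by simp
      then have "fact_code (code p) (prod_encode (x, m)) (Suc (k m)) \<in> ?T s"
        using t that stage_mono[THEN subsetD] by blast
      then show ?thesis using fact_code_bound Suc_lessD by blast
    qed
    ultimately show "eval_step g s (stage (eval_step g) s) (fact_code (code (Search p)) x n)"
      by (auto simp: eval_step_def Let_def)
  qed
qed (rule stage_complete[of 0], auto simp: eval_step_def)+

lemma phi_iff_stage: "phi g e x y \<longleftrightarrow> (\<exists>t. fact_code e x y \<in> set_decode
    (stage (eval_step g) t))"
  using eval_stage_sound eval_stage_complete unfolding phi_def by metis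

text \<open>The use principle: the candidate fact examined at stage \<open>q\<close> is coded by a
  number at most \<open>q\<close>, and so is the argument at which it could query the
  oracle.\<close>

lemma eval_stage_cong:
  assumes "\<And>q. q < t \<Longrightarrow> g q = g' q"
  shows "stage (eval_step g) t = stage (eval_step g') t"
  using assms
proof (induction t)
  case (Suc t)
  have "pfst (psnd (pfst t)) < Suc t"
    by (meson pfst_le psnd_le le_less_trans lessI order_trans)
  then have "eval_step g t S (pfst t) = eval_step g' t S (pfst t)" for S
    using Suc.prems unfolding eval_step_def by simp
  then show ?case using Suc by (simp add: stage.simps(2))
qed simp

section \<open>A modulus for hyperarithmetical sets\<close>

text \<open>
  \<open>fact_code b x v\<close> now stands for \<open>char_fun H\<^sub>b x = v\<close>. At a successor
      \<open>2 ^ c\<close> the jump is decided by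
  running the computation for \<open>h (prod_encode (c, x))\<close> stages only; such a run asks the
      oracle \<open>H\<^sub>c\<close>
  only about arguments below that number, so finitely many earlier facts suffice.
\<close>

definition H_step :: "(nat \<Rightarrow> nat) \<Rightarrow> nat \<Rightarrow> nat \<Rightarrow> nat
    \<Rightarrow> bool" where
  "H_step h s S z = (let b = pfst z; x = pfst (psnd z); v = psnd (psnd z) in
     (b = 1 \<and> v = 0) \<or>
     (\<exists>c<b. c \<noteq> 0 \<and> b = 2 ^ c \<and>
        (\<forall>q<h (prod_encode (c, x)). fact_code c q 0 \<in> set_decode S \<or> fact_code c q 1
            \<in> set_decode S) \<and>
        (let T = stage (eval_step (\<lambda>q. if fact_code c q 1 \<in> set_decode S then 1 else 0)) (h
            (prod_encode (c, x)))
         in v = (if \<exists>y<T. fact_code x x y \<in> set_decode T then 1 else 0))) \<or>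
     (\<exists>e<b. b = 3 * 5 ^ e \<and>
        (\<exists>k<stage (eval_step (\<lambda>_. 0)) s. fact_code e (psnd x) k \<in> set_decode (stage
            (eval_step (\<lambda>_. 0)) s) \<and>
           fact_code k (pfst x) v \<in> set_decode S)))"

lemma H_step_sucI:
  assumes "c \<noteq> 0"
    and "\<forall>q<h (prod_encode (c, x)). fact_code c q 0 \<in> set_decode S \<or> fact_code c q 1
        \<in> set_decode S"
    and "v = (if \<exists>y<stage (eval_step (\<lambda>q. if fact_code c q 1 \<in> set_decode S then 1
        else 0)) (h (prod_encode (c, x))).
      fact_code x x y \<in> set_decode (stage (eval_step (\<lambda>q. if fact_code c q 1 \<in>
          set_decode S then 1 else 0))
        (h (prod_encode (c, x)))) then 1 else 0)"
  shows "H_step h s S (fact_code (2 ^ c) x v)"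
  unfolding H_step_def Let_def pfst_encode psnd_encode
  by (intro disjI2 disjI1 exI[of _ c] conjI less_exp refl assms)

lemma H_step_limI:
  assumes "fact_code e (psnd x) k \<in> set_decode (stage (eval_step (\<lambda>_. 0)) s)"
    and "fact_code k (pfst x) v \<in> set_decode S"
  shows "H_step h s S (fact_code (3 * 5 ^ e) x v)"
proof -
  have "e < 3 * 5 ^ e" by (induction e) auto
  then show ?thesis
    unfolding H_step_def Let_def pfst_encode psnd_encode
    by (intro disjI2 exI[of _ e] exI[of _ k] conjI refl assms fact_code_bound[OF assms(1)])
qed

lemma computable_from_H_stage:
  assumes "computable_from h k"
  shows "computable_from h (\<lambda>x. stage (H_step h) (k x))"
  by (rule computable_from_stage[where \<Phi> = "\<lambda>_. H_step h" and a = "\<lambda>x. x", OF _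
      computable_from_id assms])
    (unfold H_step_def Let_def, intro computable_from_eval_stage computable_from_oracle comp_intros)

section \<open>Settling times of the jump\<close>

definition settles :: "nat set \<Rightarrow> nat \<Rightarrow> nat \<Rightarrow> bool" where
  "settles X x t \<longleftrightarrow> (\<exists>y. fact_code x x y \<in> set_decode (stage (eval_step
      (char_fun X)) t))"

lemma turing_jump_iff_settles: "x \<in> turing_jump X \<longleftrightarrow> (\<exists>t. settles X x t)"
  unfolding turing_jump_def settles_def mem_Collect_eq phi_iff_stage by blast

lemma settles_mono: "settles X x s \<Longrightarrow> s \<le> t \<Longrightarrow> settles X x t"
  unfolding settles_def using stage_mono by blast

text \<open>A single \<open>h\<close> serves all H-sets at once, and waiting longer does no harm;
  this upward closure is what makes it a modulus.\<close>

definition settling_bound :: "(nat \<Rightarrow> nat) \<Rightarrow> bool" where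
  "settling_bound h \<longleftrightarrow>
    (\<forall>c X x. H_set c X \<longrightarrow> x \<in> turing_jump X \<longrightarrow> settles X x (h
        (prod_encode (c, x))))"

text \<open>By \<open>H_set_unique\<close> each notation has at most one H-set, so each pair of a
  notation and an input asks for at most one settling stage.\<close>

lemma settling_bound_exists: "\<exists>g. settling_bound g"
proof -
  have "\<exists>t. \<forall>X. H_set (pfst n) X \<longrightarrow> psnd n \<in> turing_jump X
      \<longrightarrow> settles X (psnd n) t" for n
    using H_set_unique turing_jump_iff_settles by metis
  then obtain g where "\<forall>n X. H_set (pfst n) X \<longrightarrow> psnd n \<in> turing_jump X
      \<longrightarrow> settles X (psnd n) (g n)"
    by metis
  then show ?thesis unfolding settling_bound_def by (metis pfst_encode psnd_encode)
qed

lemma settling_bound_dominates: "settling_bound g \<Longrightarrow> dominates h g \<Longrightarrow>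
    settling_bound h"
  unfolding settling_bound_def dominates_def using settles_mono by blast

lemma eventually_forall_less:
  assumes mono: "\<And>q s t. s \<le> t \<Longrightarrow> P q s \<Longrightarrow> P q t" and ex:
      "\<And>q. \<exists>s. P q s"
  shows "\<exists>s::nat. \<forall>q<n::nat. P q s"
proof (induction n)
  case (Suc n)
  then obtain s where s: "\<forall>q<n. P q s" by blast
  obtain s' where s': "P n s'" using ex by blast
  have "\<forall>q<Suc n. P q (max s s')"
    using mono s s' by (metis less_Suc_eq max.cobounded1 max.cobounded2)
  then show ?case ..
qed simp

text \<open>Induction along the notation, with soundness and completeness together. At a successor,
  soundness for \<open>c\<close> makes the simulated oracle correct, and completeness for
  \<open>c\<close> guarantees that the awaited oracle facts arrive.\<close>

lemma H_stage_correct: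
  assumes h: "settling_bound h" and "H_set a X"
  shows "fact_code a x v \<in> set_decode (stage (H_step h) s) \<Longrightarrow> v = char_fun X x"
    and "\<exists>s. fact_code a x (char_fun X x) \<in> set_decode (stage (H_step h) s)"
proof -
  let ?F = "\<lambda>s. set_decode (stage (H_step h) s)"
  have F_mono: "z \<in> ?F s \<Longrightarrow> s \<le> t \<Longrightarrow> z \<in> ?F t" for z s t
      using stage_mono by blast
  have "(\<forall>s x v. fact_code a x v \<in> ?F s \<longrightarrow> v = char_fun X x) \<and>
      (\<forall>x. \<exists>s. fact_code a x (char_fun X x) \<in> ?F s)"
    using \<open>H_set a X\<close>
  proof induction
    case H_zero
    have "v = 0" if "fact_code 1 x v \<in> ?F s" for x v s
    proof -
      from stage_sound[OF that] obtain s' where "H_step h s' (stage (H_step h) s') (fact_code 1 x v)" by blast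
      then show ?thesis by (auto simp: H_step_def Let_def)
    qed
    moreover have "\<exists>s. fact_code 1 x 0 \<in> ?F s" for x
      by (rule stage_complete[of 0]) (simp add: H_step_def)
    ultimately show ?case by (auto simp: char_fun_def)
  next
    case (H_suc c X)
    from kleene_O_pos[OF \<open>kleene_O c\<close>] have c0: "c \<noteq> 0" by simp
    define o_of where "o_of S = (\<lambda>q. if fact_code c q 1 \<in> set_decode S then 1 else 0 :: nat)" for S
    let ?T = "\<lambda>S x. stage (eval_step (o_of S)) (h (prod_encode (c, x)))"
    \<comment> \<open>When every query below the bound is answered, the simulated oracle agrees with
      \<open>X\<close> there, and a run of that length asks nothing beyond. The settling bound turns
      halting within the run into membership in the jump.\<close>
    have step: "(\<exists>y<?T (stage (H_step h) s) x. fact_code x x y \<in> set_decode (?T (stage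
        (H_step h) s) x))
        \<longleftrightarrow> x \<in> turing_jump X"
      if "\<forall>q<h (prod_encode (c, x)). fact_code c q 0 \<in> ?F s \<or> fact_code c q 1 \<in> ?F
          s" for s x
    proof -
      have "?T (stage (H_step h) s) x = stage (eval_step (char_fun X)) (h (prod_encode (c, x)))"
        using that H_suc.IH by (intro eval_stage_cong) (auto simp: o_of_def)
      moreover have "x \<in> turing_jump X \<longleftrightarrow> settles X x (h (prod_encode (c, x)))"
        using h H_suc.hyps unfolding settling_bound_def turing_jump_iff_settles by blast
      ultimately show ?thesis unfolding settles_def using fact_code_bound by metis
    qed
    have "v = char_fun (turing_jump X) x" if "fact_code (2 ^ c) x v \<in> ?F s" for x v s
    proof -
      from stage_sound[OF that] obtain s' where
        "H_step h s' (stage (H_step h) s') (fact_code (2 ^ c) x v)" by blast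
      then have "\<forall>q<h (prod_encode (c, x)). fact_code c q 0 \<in> ?F s' \<or> fact_code c q 1
          \<in> ?F s'"
        and "v = (if \<exists>y<?T (stage (H_step h) s') x.
          fact_code x x y \<in> set_decode (?T (stage (H_step h) s') x) then 1 else 0)"
        \<comment> \<open>\<open>c0\<close> excludes the clause for the notation 1, the other fact
          the clause for limits.\<close>
        using c0 lim_notation_not_power_two[OF sym] by (auto simp: H_step_def Let_def o_of_def)
      with step show ?thesis by (simp add: char_fun_def)
    qed
    moreover have "\<exists>s. fact_code (2 ^ c) x (char_fun (turing_jump X) x) \<in> ?F s" for x
    proof -
      have "\<exists>s. fact_code c q 0 \<in> ?F s \<or> fact_code c q 1 \<in> ?F s" for q
        using H_suc.IH unfolding char_fun_def by metis
      then obtain s0 where s0: "\<forall>q<h (prod_encode (c, x)). fact_code c q 0 \<in> ?F s0 \<or>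
          fact_code c q 1 \<in> ?F s0"
        using eventually_forall_less[of "\<lambda>q s. fact_code c q 0 \<in> ?F s \<or> fact_code c q 1
            \<in> ?F s"] F_mono
        by meson
      show ?thesis
      proof (rule stage_complete[of s0])
        fix s assume "s0 \<le> s"
        then have s: "\<forall>q<h (prod_encode (c, x)). fact_code c q 0 \<in> ?F s \<or> fact_code c q
            1 \<in> ?F s"
          using s0 F_mono by blast
        have "char_fun (turing_jump X) x = (if \<exists>y<?T (stage (H_step h) s) x.
            fact_code x x y \<in> set_decode (?T (stage (H_step h) s) x) then 1 else 0)"
          by (simp add: step[OF s] char_fun_def)
        then show "H_step h s (stage (H_step h) s) (fact_code (2 ^ c) x (char_fun (turing_jump X) x))"
          unfolding o_of_def by (intro H_step_sucI c0 s)
      qed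
    qed
    ultimately show ?case by blast
  next
    case (H_lim e s Y)
    let ?T = "\<lambda>t. set_decode (stage (eval_step (\<lambda>_. 0)) t)"
    have char: "char_fun {prod_encode (x, n) |x n. x \<in> Y n} x = char_fun (Y (psnd x)) (pfst x)" for x
    proof -
      obtain y n where "x = prod_encode (y, n)" by (metis encode_pfst_psnd)
      then show ?thesis by (simp add: char_fun_def)
    qed
    have "v = char_fun (Y (psnd x)) (pfst x)" if "fact_code (3 * 5 ^ e) x v \<in> ?F t" for x v t
    proof -
      from stage_sound[OF that] obtain t' where
        "H_step h t' (stage (H_step h) t') (fact_code (3 * 5 ^ e) x v)" by blast
      then obtain k where k: "fact_code e (psnd x) k \<in> ?T t'" "fact_code k (pfst x) v \<in> ?F t'"
        using lim_notation_not_power_two lim_notation_not_power_two[of e 0] by (auto simp: H_step_def Let_def)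
      from k(1) have "k = s (psnd x)"
        using eval_stage_sound phi_deterministic H_lim.hyps by blast
      with k(2) show ?thesis using H_lim.IH by blast
    qed
    moreover have "\<exists>t. fact_code (3 * 5 ^ e) x (char_fun (Y (psnd x)) (pfst x)) \<in> ?F t" for x
    proof -
      obtain t1 where t1: "fact_code e (psnd x) (s (psnd x)) \<in> ?T t1"
        using H_lim.hyps phi_iff_stage by blast
      obtain t2 where t2: "fact_code (s (psnd x)) (pfst x) (char_fun (Y (psnd x)) (pfst x)) \<in> ?F t2"
        using H_lim.IH by blast
      show ?thesis
      proof (rule stage_complete[of "max t1 t2"])
        fix t assume t: "max t1 t2 \<le> t"
        have "fact_code e (psnd x) (s (psnd x)) \<in> ?T t" using t1 t stage_mono by (meson
            max.boundedE subsetD)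
        moreover have "fact_code (s (psnd x)) (pfst x) (char_fun (Y (psnd x)) (pfst x)) \<in> ?F t"
          using t2 t F_mono by auto
        ultimately show "H_step h t (stage (H_step h) t)
            (fact_code (3 * 5 ^ e) x (char_fun (Y (psnd x)) (pfst x)))"
          by (intro H_step_limI)
      qed
    qed
    ultimately show ?case unfolding char by blast
  qed
  then show "fact_code a x v \<in> ?F s \<Longrightarrow> v = char_fun X x" "\<exists>s. fact_code a x
      (char_fun X x) \<in> ?F s"
    by blast+
qed

text \<open>Wait for the first stage with a value for \<open>x\<close> and read it off: completeness
  makes the search halt, soundness makes the value right.\<close>

lemma settling_bound_computes_H_set:
  assumes "settling_bound h" "H_set a X"
  shows "computable_from h (char_fun X)"
proof -
  let ?F = "\<lambda>s. set_decode (stage (H_step h) s)"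
  let ?P = "\<lambda>x s. fact_code a x 0 \<in> ?F s \<or> fact_code a x 1 \<in> ?F s"
  note sound = H_stage_correct(1)[OF assms] and complete = H_stage_correct(2)[OF assms]
  have ex: "\<exists>s. ?P x s" for x
    using complete[of x] by (auto simp: char_fun_def split: if_splits)
  have "computable_from h (\<lambda>x. LEAST s. ?P x s)"
    by (rule computable_from_Least[OF _ ex]) (intro comp_intros computable_from_H_stage)
  then have "computable_from h (\<lambda>x. if fact_code a x 1 \<in> ?F (LEAST s. ?P x s) then 1 else 0)"
    by (intro comp_intros computable_from_H_stage)
  then show ?thesis
  proof (rule computable_from_cong)
    fix x
    have "?P x (LEAST s. ?P x s)" using ex by (rule LeastI_ex)
    then show "(if fact_code a x 1 \<in> ?F (LEAST s. ?P x s) then 1 else 0) = char_fun X x"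
      using sound by fastforce
  qed
qed

lemma hyperarithmetical_modulus:
  assumes "hyperarithmetical A"
  shows "\<exists>g. mono g \<and> (\<forall>h. dominates h g \<longrightarrow> computable_from h (char_fun A))"
proof -
  obtain a X where X: "H_set a X" "computes X A"
    using assms unfolding hyperarithmetical_def by blast
  obtain g where g: "settling_bound g" using settling_bound_exists by blast
  \<comment> \<open>Partial sums give a monotone function above \<open>g\<close>; monotonicity is
    used to compute from sparse sets.\<close>
  let ?g = "\<lambda>n. \<Sum>m\<le>n. g m"
  have "mono ?g" by (intro monoI sum_mono2) auto
  moreover have "computable_from h (char_fun A)" if h: "dominates h ?g" for h
  proof -
    have "g n \<le> ?g n" for n by (rule member_le_sum) auto
    then have "dominates h g" using h unfolding dominates_def by (meson order_trans)
    then show ?thesis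
      using settling_bound_computes_H_set settling_bound_dominates g X computable_from_trans
      unfolding computes_def by blast
  qed
  ultimately show ?thesis by blast
qed

section \<open>The colouring\<close>

text \<open>The extra top bit \<open>n\<close> marks the length of the initial segment, so that
  different lengths have different codes even where \<open>A\<close> has gaps.\<close>

definition prefix_code :: "nat set \<Rightarrow> nat \<Rightarrow> nat" where
  "prefix_code A n = set_encode (insert n (A \<inter> {..<n}))"

lemma set_decode_prefix_code: "set_decode (prefix_code A n) = insert n (A \<inter> {..<n})"
  unfolding prefix_code_def by (rule set_encode_inverse) simp

lemma prefix_code_bounds: "2 ^ n \<le> prefix_code A n" "prefix_code A n < 2 ^ Suc n"
proof -
  have *: "prefix_code A n = (\<Sum>i\<in>A \<inter> {..<n}. 2 ^ i) + 2 ^ n"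
    unfolding prefix_code_def set_encode_def by (subst sum.insert) auto
  have "(\<Sum>i\<in>A \<inter> {..<n}. 2 ^ i) \<le> (\<Sum>i<n. 2 ^ i :: nat)" by (rule sum_mono2) auto
  also have "\<dots> < 2 ^ n" by (simp add: lessThan_atLeast0 sum_power2)
  finally show "2 ^ n \<le> prefix_code A n" "prefix_code A n < 2 ^ Suc n" by (simp_all add: *)
qed

lemma strict_mono_prefix_code: "strict_mono (prefix_code A)"
  unfolding strict_mono_Suc_iff using prefix_code_bounds less_le_trans by blast

section \<open>Computing \<open>A\<close> from an infinite set\<close>

lemma computable_from_next_element:
  assumes "infinite H" "computable_from (char_fun H) b"
  shows "computable_from (char_fun H) (\<lambda>x. LEAST y. y \<in> H \<and> b x < y)"
proof (rule computable_from_Least)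
  have "decidable_from (char_fun H) (\<lambda>y. y \<in> H)"
    unfolding decidable_from_def by (rule computable_from_cong[OF computable_from_oracle[OF
        computable_from_id]]) (simp add: char_fun_def)
  then show "decidable_from (char_fun H) (\<lambda>z. psnd z \<in> H \<and> b (pfst z) < psnd z)"
    by (intro comp_intros decidable_from_comp[where k = psnd] computable_from_comp[OF assms(2)])
  show "\<exists>n. n \<in> H \<and> b x < n" for x
    using assms(1) by (metis infinite_nat_iff_unbounded)
qed

lemma next_element:
  assumes "infinite (H :: nat set)"
  shows "(LEAST y. y \<in> H \<and> b < y) \<in> H" "b < (LEAST y. y \<in> H \<and> b < y)"
proof -
  have "\<exists>y. y \<in> H \<and> b < y" using assms by (metis infinite_nat_iff_unbounded)
  from LeastI_ex[OF this] show "(LEAST y. y \<in> H \<and> b < y) \<in> H" "b < (LEAST y. y \<in> H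
      \<and> b < y)" by simp_all
qed

lemma prefix_codes_compute:
  assumes H: "infinite H" and "finite (H - range (prefix_code A))"
  shows "computes H A"
proof -
  obtain N where N: "\<And>w. w \<in> H \<Longrightarrow> N < w \<Longrightarrow> w \<in> range (prefix_code A)"
    using assms(2) by (metis DiffI finite_nat_set_iff_bounded_le not_less)
  \<comment> \<open>Exceeding \<open>N\<close> avoids the finitely many exceptions; exceeding
    \<open>2 ^ Suc m\<close> forces the marker bit above \<open>m\<close>, so that bit
    \<open>m\<close> really tells whether \<open>m\<close> is in \<open>A\<close>.\<close>
  let ?w = "\<lambda>m. LEAST y. y \<in> H \<and> 2 ^ Suc m + N < y"
  have "computable_from (char_fun H) (\<lambda>m. if m \<in> set_decode (?w m) then 1 else 0)"
    by (intro comp_intros computable_from_next_element H)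
  then show ?thesis
    unfolding computes_def
  proof (rule computable_from_cong)
    fix m
    note w = next_element[OF H, of "2 ^ Suc m + N"]
    then obtain n where n: "?w m = prefix_code A n" using N[of "?w m"] by auto
    have "2 ^ Suc m < (2 ^ Suc n :: nat)" using w(2) prefix_code_bounds(2)[of A n] n by linarith
    then have "m < n" by simp
    then show "(if m \<in> set_decode (?w m) then 1 else 0) = char_fun A m"
      unfolding n by (auto simp: set_decode_prefix_code char_fun_def)
  qed
qed

text \<open>Two steps along \<open>H\<close> beat \<open>g\<close>: the first reaches an element
  above \<open>b\<close>, and sparseness puts the second beyond the value of \<open>g\<close> there,
  which by monotonicity is at least \<open>g b\<close>.\<close>

lemma sparse_set_computes:
  assumes g: "mono g" "\<forall>h. dominates h g \<longrightarrow> computable_from h (char_fun A)"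
    and H: "infinite H" and sparse: "\<And>x y. x \<in> H \<Longrightarrow> y \<in> H \<Longrightarrow>
        x < y \<Longrightarrow> g x < y"
  shows "computes H A"
proof -
  let ?n = "\<lambda>b. LEAST y. y \<in> H \<and> b < y"
  have "computable_from (char_fun H) (\<lambda>b. ?n (?n b))"
    by (intro comp_intros computable_from_next_element H)
  moreover have "dominates (\<lambda>b. ?n (?n b)) g"
    unfolding dominates_def
  proof
    fix b
    have "g b \<le> g (?n b)" using next_element(2)[OF H, of b] g(1) by (simp add: monoD)
    also have "\<dots> < ?n (?n b)" by (intro sparse next_element[OF H])
    finally show "g b \<le> ?n (?n b)" by simp
  qed
  ultimately show ?thesis unfolding computes_def using g(2) computable_from_trans by blast
qed

lemma principal_function_range:
  assumes "strict_mono (s :: nat \<Rightarrow> nat)"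
  shows "principal_function (range s) n \<le> s n"
proof -
  have inf: "infinite (range s)" using assms by (simp add: range_inj_infinite strict_mono_imp_inj_on)
  show ?thesis unfolding principal_function_def
  proof (induction n)
    case 0
    then show ?case by (simp add: enumerate_0 Least_le)
  next
    case (Suc n)
    \<comment> \<open>Thus \<open>s (Suc n)\<close> competes for the least element after the
      \<open>n\<close>-th.\<close>
    have "enumerate (range s) n < s (Suc n)" using Suc assms by (meson le_less_trans lessI strict_monoD)
    then show ?case by (simp add: enumerate_Suc'' inf Least_le)
  qed
qed

theorem theorem2p6:
  fixes A :: "nat set"
  assumes "hyperarithmetical A"
  shows "\<exists>f \<in> nsets UNIV 2 \<rightarrow> {..<2::nat}.
    (\<forall>H. infinite H \<and> (\<exists>i<2. homogeneous f i H) \<longrightarrow> computes H A) \<and>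
    (\<forall>i<2. \<exists>H. infinite H \<and> homogeneous f i H \<and>
       (\<exists>h. computable h \<and> dominates h (principal_function H)))"
proof -
  obtain g where g: "mono g" "\<forall>h. dominates h g \<longrightarrow> computable_from h (char_fun A)"
    using hyperarithmetical_modulus[OF assms] by blast
  define s where "s i n = prefix_code A (2 * n + i)" for i n
  define B where "B = - (range (s 0) \<union> range (s 1))"
  define red where "red x y \<longleftrightarrow> x \<in> range (s 0) \<and> y \<in> range (s 0) \<or>
      x \<in> B \<and> y \<in> B \<and> g x < y" for x y
  define f where "f S = (if red (Min S) (Max S) then 0 else 1 :: nat)" for S
  have f: "f {x, y} = (if red x y then 0 else 1)" if "x < y" for x y
    using that by (simp add: f_def max_def min_def)
  have s_mono: "strict_mono (s i)" for i
    unfolding s_def strict_mono_def by (intro allI impI strict_monoD[OF strict_mono_prefix_code]) simp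
  have s_inf: "infinite (range (s i))" for i
    using s_mono by (simp add: range_inj_infinite strict_mono_imp_inj_on)
  have s_sub: "range (s i) \<subseteq> range (prefix_code A)" for i by (auto simp: s_def)
  have disj: "range (s 0) \<inter> range (s 1) = {}"
  proof -
    have "s 0 m \<noteq> s 1 n" for m n
      using strict_mono_eq[OF strict_mono_prefix_code, of A "2 * m" "2 * n + 1"] unfolding s_def
      by (metis add.right_neutral even_add even_mult_iff even_numeral odd_one)
    then show ?thesis by blast
  qed
  have 0: "computes H A" if H: "infinite H" and hom: "homogeneous f 0 H" for H
  proof -
    have r: "red x y" if "x \<in> H" "y \<in> H" "x < y" for x y
      using hom that f[of x y] unfolding homogeneous_def by (metis zero_neq_one)
    show ?thesis
    proof (cases "H \<subseteq> B")
      case True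
      then show ?thesis
        using r disj B_def by (intro sparse_set_computes[OF g H]) (unfold red_def, blast)
    next
      case False
      then obtain x where x: "x \<in> H" "x \<notin> B" by blast
      \<comment> \<open>As \<open>x\<close> is outside \<open>B\<close>, a red pair with a later
        element \<open>z\<close> puts \<open>x\<close> into the first class; red pairs never mix
        classes, so all of \<open>H\<close> follows.\<close>
      have "y \<in> range (s 0)" if "y \<in> H" for y
      proof -
        obtain z where "z \<in> H" "x < z" using H by (metis infinite_nat_iff_unbounded)
        then have "x \<in> range (s 0)" using r[of x z] x unfolding red_def by blast
        then show ?thesis using r[of x y] r[of y x] x that unfolding red_def B_def
          by (cases x y rule: linorder_cases) blast+
      qed
      then have "H - range (prefix_code A) = {}" using s_sub[of 0] by blast
      then show ?thesis using prefix_codes_compute[OF H] by (metis finite.emptyI)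
    qed
  qed
  have 1: "computes H A" if H: "infinite H" and hom: "homogeneous f 1 H" for H
  proof (rule prefix_codes_compute[OF H])
    have r: "\<not> red x y" if "x \<in> H" "y \<in> H" "x < y" for x y
      using hom that f[of x y] unfolding homogeneous_def by (metis zero_neq_one)
    show "finite (H - range (prefix_code A))"
    proof (cases "H \<inter> B = {}")
      case True
      then have "H - range (prefix_code A) = {}" using s_sub unfolding B_def by blast
      then show ?thesis by (simp only: finite.emptyI)
    next
      case False
      then obtain x where x: "x \<in> H" "x \<in> B" by blast
      \<comment> \<open>A larger \<open>y\<close> would form a red pair with \<open>x\<close>, so
        \<open>H\<close> meets the third class in a finite set only.\<close>
      have "y \<le> max x (g x)" if "y \<in> H" "y \<in> B" for y
        using r[of x y] x that unfolding red_def by (cases "x < y") auto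
      then have "H \<inter> B \<subseteq> {..max x (g x)}" by auto
      then have "finite (H \<inter> B)" using finite_subset by blast
      moreover have "H - range (prefix_code A) \<subseteq> H \<inter> B" using s_sub unfolding B_def by blast
      ultimately show ?thesis using finite_subset by blast
    qed
  qed
  have dom: "\<exists>h. computable h \<and> dominates h (principal_function (range (s i)))" if "i < 2" for i
  proof (intro exI conjI)
    \<comment> \<open>The \<open>n\<close>-th element of class \<open>i\<close> is at most the code
      of the prefix of length \<open>2 * n + i\<close>, whose top bit is \<open>2 * n + i\<close>;
      the bound does not mention \<open>A\<close>.\<close>
    show "computable (\<lambda>n. 2 ^ Suc (2 * n + i))"
      unfolding computable_def by (intro comp_intros)
    show "dominates (\<lambda>n. 2 ^ Suc (2 * n + i)) (principal_function (range (s i)))"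
      unfolding dominates_def
      using principal_function_range[OF s_mono] prefix_code_bounds(2) unfolding s_def
      by (meson le_less_trans less_imp_le)
  qed
  have hom: "homogeneous f i (range (s i))" if "i < 2" for i
  proof -
    have "i = 0 \<or> i = 1" using that by auto
    then show ?thesis
      using disj unfolding homogeneous_def red_def B_def by (auto simp: f red_def B_def)
  qed
  show ?thesis
  proof (intro bexI[of _ f] conjI allI impI)
    show "computes H A" if "infinite H \<and> (\<exists>i<2. homogeneous f i H)" for H
      using that 0 1 less_2_cases by (metis One_nat_def)
    show "\<exists>H. infinite H \<and> homogeneous f i H \<and>
        (\<exists>h. computable h \<and> dominates h (principal_function H))" if "i < 2" for i
      using s_inf hom[OF that] dom[OF that] by blast
    show "f \<in> nsets UNIV 2 \<rightarrow> {..<2}" by (auto simp: f_def)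
  qed
qed

end
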